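(* Let $K$ be a field, $G$ a finite group, and assume that all representations of $G$ over $K$ are completely reducible. Let $R$ be a $G$-module over $K$ and $F\in R$. Then $F$ generates $R$ as a $K[G]$-module if and only if $F$ is generic in $R$.
   Context: An element $f$ of a $G$-module $R$ is called generic in $R$ if there exists a decomposition $R=\bigoplus_{\lambda}\bigoplus_{P\in I_\lambda} S^{P}$ of $R$ into simple submodules, indexed so that $S^{P}\cong S^{P'}$ if and only if $P,P'\in I_\lambda$ for some common $\lambda$, with the following property: for every $\lambda$ and every $P'\in I_\lambda$, if for each $P\in I_\lambda$ one chooses an isomorphism $\psi_{P,P'}:S^{P}\to S^{P'}$ and lets $f^{(P)}$ denote the component (projection) of $f$ in $S^{P}$, then the family $\{\psi_{P,P'}(f^{(P)}) : P\in I_\lambda\}\subset S^{P'}$ is $K$-linearly independent. *)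

theory Defs
  imports
    Complex_Main
    "HOL-Algebra.Group_Action"
    "HOL-Library.Disjoint_Sets"
    "HOL-Library.Function_Algebras"
begin

text \<open>
  A \<open>G\<close>-module over the field \<open>'k\<close> is a subspace \<open>R\<close> of an ambient \<open>'k\<close>-vector space \<open>'v\<close>
  with an action of \<open>G\<close> on \<open>R\<close> by linear maps; \<open>R\<close> may be infinite-dimensional.
  The library's \<^locale>\<open>group_action\<close> makes every \<open>\<rho> g\<close> a bijection of \<open>R\<close> that is
  \<^const>\<open>undefined\<close> off \<open>R\<close>, so \<open>\<rho>\<close> carries no information outside \<open>R\<close>.
\<close>

locale G_module =
  vector_space scale + group_action G R \<rho>
  for scale :: "'k::field \<Rightarrow> 'v::ab_group_add \<Rightarrow> 'v" (infixr \<open>*s\<close> 75)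
    and G :: "('g, 'm) monoid_scheme" (structure)
    and R :: "'v set"
    and \<rho> :: "'g \<Rightarrow> 'v \<Rightarrow> 'v" +
  assumes subspace_R: "subspace R"
    and act_add: "\<lbrakk>g \<in> carrier G; x \<in> R; y \<in> R\<rbrakk> \<Longrightarrow> \<rho> g (x + y) = \<rho> g x + \<rho> g y"
    and act_scale: "\<lbrakk>g \<in> carrier G; x \<in> R\<rbrakk> \<Longrightarrow> \<rho> g (c *s x) = c *s \<rho> g x"
begin

definition submodule :: "'v set \<Rightarrow> bool" where
  "submodule S \<longleftrightarrow> subspace S \<and> S \<subseteq> R \<and> (\<forall>g\<in>carrier G. \<rho> g ` S \<subseteq> S)"

definition simple_submodule :: "'v set \<Rightarrow> bool" where
  "simple_submodule S \<longleftrightarrow>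
     submodule S \<and> S \<noteq> {0} \<and> (\<forall>T. submodule T \<and> T \<subseteq> S \<longrightarrow> T = {0} \<or> T = S)"

definition module_iso :: "'v set \<Rightarrow> 'v set \<Rightarrow> ('v \<Rightarrow> 'v) \<Rightarrow> bool" where
  "module_iso S T \<psi> \<longleftrightarrow>
     bij_betw \<psi> S T \<and>
     (\<forall>x\<in>S. \<forall>y\<in>S. \<psi> (x + y) = \<psi> x + \<psi> y) \<and>
     (\<forall>c. \<forall>x\<in>S. \<psi> (c *s x) = c *s \<psi> x) \<and>
     (\<forall>g\<in>carrier G. \<forall>x\<in>S. \<psi> (\<rho> g x) = \<rho> g (\<psi> x))"

definition isomorphic :: "'v set \<Rightarrow> 'v set \<Rightarrow> bool" where
  "isomorphic S T \<longleftrightarrow> (\<exists>\<psi>. module_iso S T \<psi>)"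

text \<open>
  \<open>components D v x\<close>: the family \<open>x P \<in> P\<close>, for \<open>P \<in> D\<close>, has finite support and sum \<open>v\<close>.
  The convention \<open>x P = 0\<close> for \<open>P \<notin> D\<close> makes \<open>x\<close> unique as a function when the sum is direct.
\<close>

definition components :: "'v set set \<Rightarrow> 'v \<Rightarrow> ('v set \<Rightarrow> 'v) \<Rightarrow> bool" where
  "components D v x \<longleftrightarrow>
     (\<forall>P\<in>D. x P \<in> P) \<and> (\<forall>P. P \<notin> D \<longrightarrow> x P = 0) \<and>
     finite {P. x P \<noteq> 0} \<and> v = (\<Sum>P | x P \<noteq> 0. x P)"

text \<open>
  The summands of a direct sum of simple modules are nonzero, hence pairwise distinct, so
  the summands themselves can serve as the index set of the decomposition.
\<close>

definition simple_decomposition :: "'v set set \<Rightarrow> bool" where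
  "simple_decomposition D \<longleftrightarrow>
     (\<forall>P\<in>D. simple_submodule P) \<and> (\<forall>v\<in>R. \<exists>!x. components D v x)"

definition component :: "'v set set \<Rightarrow> 'v \<Rightarrow> 'v set \<Rightarrow> 'v" where
  "component D v = (THE x. components D v x)"

definition completely_reducible :: bool where
  "completely_reducible \<longleftrightarrow> (\<exists>D. simple_decomposition D)"

text \<open>
  Linear independence of an indexed family: the members are distinct and form an
  independent set.  (The bare set of members would not see repetitions.)
\<close>

definition independent_family :: "'i set \<Rightarrow> ('i \<Rightarrow> 'v) \<Rightarrow> bool" where
  "independent_family I u \<longleftrightarrow> inj_on u I \<and> independent (u ` I)"

text \<open>
  \<open>\<I>\<close> is the collection of the index sets \<open>I\<^sub>\<lambda>\<close>.  The isomorphisms \<open>\<psi> P\<close> onto \<open>P'\<close> are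
  universally quantified: since simple modules may have endomorphism rings larger than the
  field, the independence can depend on their choice.
\<close>

definition generic :: "'v \<Rightarrow> bool" where
  "generic f \<longleftrightarrow>
     (\<exists>D \<I>. simple_decomposition D \<and> partition_on D \<I> \<and>
        (\<forall>P\<in>D. \<forall>P'\<in>D. isomorphic P P' \<longleftrightarrow> (\<exists>I\<in>\<I>. P \<in> I \<and> P' \<in> I)) \<and>
        (\<forall>I\<in>\<I>. \<forall>P'\<in>I. \<forall>\<psi>. (\<forall>P\<in>I. module_iso P P' (\<psi> P)) \<longrightarrow>
           independent_family I (\<lambda>P. \<psi> P (component D f P))))"

text \<open>The action on \<open>R\<close> of the group algebra element \<open>\<Sum>g. a g \<cdot> g\<close>, for finite \<open>G\<close>.\<close>

definition algebra_act :: "('g \<Rightarrow> 'k) \<Rightarrow> 'v \<Rightarrow> 'v" where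
  "algebra_act a v = (\<Sum>g\<in>carrier G. a g *s \<rho> g v)"

definition generates_module :: "'v \<Rightarrow> bool" where
  "generates_module f \<longleftrightarrow> {algebra_act a f | a. True} = R"

end

text \<open>
  HOL cannot quantify over all types, so the representations are taken on the subspaces of
  \<open>'i \<Rightarrow> 'k\<close>.  Every representation whose dimension is at most the cardinality of \<open>'i\<close> has an
  isomorphic copy there, on the finitely supported functions on a basis.  With
  \<open>'i = nat + 'v\<close> this covers all finite-dimensional representations, and any module \<open>R\<close> in
  \<open>'v\<close> with its submodules and their quotients.
\<close>

definition all_representations_completely_reducible ::
  "('g, 'm) monoid_scheme \<Rightarrow> 'k::field itself \<Rightarrow> 'i itself \<Rightarrow> bool" where
  "all_representations_completely_reducible G _ _ \<longleftrightarrow>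
     (\<forall>(W :: ('i \<Rightarrow> 'k) set) \<sigma>. G_module (\<lambda>c w i. c * w i) G W \<sigma> \<longrightarrow>
        G_module.completely_reducible (\<lambda>c w i. c * w i) G W \<sigma>)"

end

theory Submission
  imports Defs
begin

text \<open>
  A relation \<open>\<Sum>P\<in>J. a P \<cdot> \<psi> P (F\<^sub>P) = 0\<close> says that the homomorphism \<open>\<Sum>P\<in>J. a P \<cdot> \<psi> P \<circ> pr\<^sub>P\<close>
  from \<open>R\<close> to a simple module kills \<open>F\<close>.  If \<open>F\<close> generates \<open>R\<close>, this homomorphism is zero, and
  restricting it to the summands gives \<open>a = 0\<close>; so \<open>F\<close> is generic with respect to every simple
  decomposition.  Conversely, a generic \<open>F\<close> has only nonzero components, so there are finitely
  many summands.  If \<open>F\<close> generated a proper submodule, that submodule would lie in the kernel of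
  a projection of \<open>R\<close> onto some summand \<open>P\<close>.  By Schur's lemma the projection is zero or an
  isomorphism on each summand, and as it kills \<open>F\<close>, choosing those isomorphisms as the \<open>\<psi> Q\<close>
  makes the components of \<open>F\<close> dependent.
\<close>

section \<open>Submodules and Schur's lemma\<close>

context G_module
begin

lemma act_closed: "\<lbrakk>g \<in> carrier G; x \<in> R\<rbrakk> \<Longrightarrow> \<rho> g x \<in> R"
  using element_image by blast

lemma act_one: "x \<in> R \<Longrightarrow> \<rho> \<one> x = x"
  using id_eq_one by (metis restrict_apply')

lemma zero_in_R: "0 \<in> R"
  using subspace_R subspace_0 by blast

lemma act_zero: "g \<in> carrier G \<Longrightarrow> \<rho> g 0 = 0"
  using act_add[of g 0 0] zero_in_R by simp

lemma sum_in_R: "(\<And>i. i \<in> I \<Longrightarrow> f i \<in> R) \<Longrightarrow> sum f I \<in> R"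
  using subspace_R subspace_sum by blast

lemma act_sum:
  assumes "g \<in> carrier G" "\<And>i. i \<in> I \<Longrightarrow> f i \<in> R"
  shows "\<rho> g (sum f I) = (\<Sum>i\<in>I. \<rho> g (f i))"
  using assms(2)
  by (induction I rule: infinite_finite_induct)
     (auto simp: act_zero assms(1) act_add sum_in_R)

lemma submoduleD:
  assumes "submodule S"
  shows "subspace S" "S \<subseteq> R" "0 \<in> S"
    and "\<And>x y. x \<in> S \<Longrightarrow> y \<in> S \<Longrightarrow> x + y \<in> S"
    and "\<And>x y. x \<in> S \<Longrightarrow> y \<in> S \<Longrightarrow> x - y \<in> S"
    and "\<And>c x. x \<in> S \<Longrightarrow> c *s x \<in> S"
    and "\<And>g x. g \<in> carrier G \<Longrightarrow> x \<in> S \<Longrightarrow> \<rho> g x \<in> S"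
proof -
  show S: "subspace S" and "S \<subseteq> R"
    using assms unfolding submodule_def by auto
  show "0 \<in> S" using subspace_0[OF S] .
  show "x + y \<in> S" "x - y \<in> S" if "x \<in> S" "y \<in> S" for x y
    using subspace_add[OF S that] subspace_diff[OF S that] .
  show "c *s x \<in> S" if "x \<in> S" for c x
    using subspace_scale[OF S that] .
  show "\<rho> g x \<in> S" if "g \<in> carrier G" "x \<in> S" for g x
    using assms that unfolding submodule_def by (meson imageI subsetD)
qed

lemma submodule_R: "submodule R"
  unfolding submodule_def using subspace_R act_closed by blast

lemma submodule_Int:
  assumes "submodule S" "submodule T"
  shows "submodule (S \<inter> T)"
  using assms unfolding submodule_def by (auto simp: image_subset_iff intro: subspace_inter)

lemma submodule_span:
  assumes "A \<subseteq> R" and "\<And>g x. g \<in> carrier G \<Longrightarrow> x \<in> A \<Longrightarrow> \<rho> g x \<in> A"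
  shows "submodule (span A)"
proof -
  have sub: "span A \<subseteq> R"
    using assms(1) subspace_R span_minimal by blast
  \<comment> \<open>Membership in \<open>R\<close> is carried through the induction because the
    linearity laws for \<open>\<rho> g\<close> are available only on \<open>R\<close>.\<close>
  have "x \<in> R \<and> \<rho> g x \<in> span A" if g: "g \<in> carrier G" and x: "x \<in> span A" for g x
    using x
  proof (induction rule: span_induct_alt)
    case base
    show ?case by (simp add: act_zero g span_zero zero_in_R)
  next
    case (step c a y)
    have "a \<in> R" using step assms(1) by auto
    then have "c *s a \<in> R" "\<rho> g (c *s a) = c *s \<rho> g a"
      using act_scale[OF g] subspace_R subspace_scale by auto
    then show ?case
      using step assms(2)[OF g] act_add[OF g] subspace_add[OF subspace_R]
      by (auto intro: span_add span_base span_scale)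
  qed
  then show ?thesis
    unfolding submodule_def using sub by auto
qed

section \<open>The submodule generated by one element\<close>

lemma algebra_act_in_submodule:
  "\<lbrakk>submodule S; v \<in> S\<rbrakk> \<Longrightarrow> algebra_act a v \<in> S"
  unfolding algebra_act_def by (intro subspace_sum submoduleD)

lemma submodule_cyclic:
  assumes "v \<in> R"
  shows "submodule {algebra_act a v | a. True}"
proof -
  let ?M = "{algebra_act a v | a. True}"
  interpret G: group G using group_hom group_hom.axioms(1) by auto
  have "algebra_act (\<lambda>_. 0) v = 0"
    by (simp add: algebra_act_def)
  moreover have "algebra_act a v + algebra_act b v = algebra_act (\<lambda>g. a g + b g) v" for a b
    by (simp add: algebra_act_def scale_left_distrib sum.distrib)
  moreover have "c *s algebra_act a v = algebra_act (\<lambda>g. c * a g) v" for a c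
    by (simp add: algebra_act_def scale_sum_right)
  ultimately have "subspace ?M"
    unfolding subspace_def by auto
  moreover have "?M \<subseteq> R"
    using algebra_act_in_submodule[OF submodule_R assms] by blast
  moreover have "\<rho> h (algebra_act a v) = algebra_act (\<lambda>g. a (inv h \<otimes> g)) v"
    if h: "h \<in> carrier G" for h a
  proof -
    have "\<rho> h (algebra_act a v) = (\<Sum>g\<in>carrier G. \<rho> h (a g *s \<rho> g v))"
      unfolding algebra_act_def
      using h assms act_closed subspace_R subspace_scale by (intro act_sum) auto
    also have "\<dots> = (\<Sum>g\<in>carrier G. a g *s \<rho> (h \<otimes> g) v)"
      using h assms by (intro sum.cong) (auto simp: act_scale act_closed composition_rule)
    \<comment> \<open>Left translation by \<open>h\<close> permutes the group, so the factor
      \<open>h\<close> moves from the action into the coefficients.\<close>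
    also have "\<dots> = (\<Sum>g\<in>carrier G. a (inv h \<otimes> g) *s \<rho> g v)"
      by (rule sum.reindex_bij_witness[of _ "\<lambda>g. inv h \<otimes> g" "\<lambda>g. h \<otimes> g"])
         (use h in \<open>auto simp: G.m_assoc[symmetric]\<close>)
    finally show ?thesis by (simp add: algebra_act_def)
  qed
  ultimately show ?thesis
    unfolding submodule_def by blast
qed

text \<open>The coefficients are the delta function at the identity. Over an infinite carrier every
  sum would be 0 by convention, so finiteness of the group enters here.\<close>

lemma self_in_cyclic:
  assumes "finite (carrier G)" "v \<in> R"
  shows "v \<in> {algebra_act a v | a. True}"
proof -
  interpret G: group G using group_hom group_hom.axioms(1) by auto
  have "algebra_act (\<lambda>g. if g = \<one> then 1 else 0) v = v"
    using assms by (simp add: algebra_act_def if_distrib[of "\<lambda>c. c *s _"] sum.delta act_one cong: if_cong)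
  then show ?thesis by (metis (mono_tags, lifting) mem_Collect_eq)
qed

text \<open>This drops bijectivity from \<open>module_iso\<close>, so that projections, and linear
  combinations of isomorphisms composed with projections, are covered.\<close>

definition module_map :: "'v set \<Rightarrow> 'v set \<Rightarrow> ('v \<Rightarrow> 'v) \<Rightarrow> bool" where
  "module_map S T \<phi> \<longleftrightarrow>
     \<phi> ` S \<subseteq> T \<and>
     (\<forall>x\<in>S. \<forall>y\<in>S. \<phi> (x + y) = \<phi> x + \<phi> y) \<and>
     (\<forall>c. \<forall>x\<in>S. \<phi> (c *s x) = c *s \<phi> x) \<and>
     (\<forall>g\<in>carrier G. \<forall>x\<in>S. \<phi> (\<rho> g x) = \<rho> g (\<phi> x))"

lemma module_iso_iff: "module_iso S T \<psi> \<longleftrightarrow> module_map S T \<psi> \<and> bij_betw \<psi> S T"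
  unfolding module_iso_def module_map_def bij_betw_def by auto

lemma module_mapD:
  assumes "module_map S T \<phi>"
  shows "\<And>x. x \<in> S \<Longrightarrow> \<phi> x \<in> T"
    and "\<And>x y. x \<in> S \<Longrightarrow> y \<in> S \<Longrightarrow> \<phi> (x + y) = \<phi> x + \<phi> y"
    and "\<And>c x. x \<in> S \<Longrightarrow> \<phi> (c *s x) = c *s \<phi> x"
    and "\<And>g x. g \<in> carrier G \<Longrightarrow> x \<in> S \<Longrightarrow> \<phi> (\<rho> g x) = \<rho> g (\<phi> x)"
  using assms unfolding module_map_def by auto

lemma module_map_subset: "module_map S T \<phi> \<Longrightarrow> S' \<subseteq> S \<Longrightarrow> module_map S' T \<phi>"
  unfolding module_map_def by blast

lemma module_map_zero:
  assumes "submodule S" "module_map S T \<phi>"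
  shows "\<phi> 0 = 0"
proof -
  have "\<phi> (0 *s 0) = 0 *s \<phi> 0"
    using assms submoduleD(3) unfolding module_map_def by blast
  then show ?thesis by simp
qed

lemma module_map_diff:
  assumes "submodule S" "module_map S T \<phi>" "x \<in> S" "y \<in> S"
  shows "\<phi> (x - y) = \<phi> x - \<phi> y"
proof -
  have "\<phi> (x - y + y) = \<phi> (x - y) + \<phi> y"
    using assms submoduleD(5) unfolding module_map_def by blast
  then show ?thesis by (simp add: algebra_simps)
qed

lemma module_map_sum:
  assumes "submodule S" "module_map S T \<phi>" "\<And>i. i \<in> I \<Longrightarrow> f i \<in> S"
  shows "\<phi> (sum f I) = (\<Sum>i\<in>I. \<phi> (f i))"
  using assms(3)
proof (induction I rule: infinite_finite_induct)
  case (insert i I)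
  have "sum f I \<in> S"
    using insert.prems submoduleD(1)[OF assms(1)] by (intro subspace_sum) auto
  then show ?case
    using insert assms(2) unfolding module_map_def by auto
qed (use module_map_zero assms in auto)

lemma submodule_kernel:
  assumes "submodule S" "submodule T" "module_map S T \<phi>"
  shows "submodule {x \<in> S. \<phi> x = 0}"
  unfolding submodule_def
proof (intro conjI ballI)
  show "subspace {x \<in> S. \<phi> x = 0}"
    using assms submoduleD[OF assms(1)] module_map_zero[OF assms(1,3)]
    unfolding subspace_def module_map_def by auto
  show "{x \<in> S. \<phi> x = 0} \<subseteq> R"
    using submoduleD[OF assms(1)] by auto
  show "\<rho> g ` {x \<in> S. \<phi> x = 0} \<subseteq> {x \<in> S. \<phi> x = 0}" if "g \<in> carrier G" for g
    using that assms submoduleD[OF assms(1)] act_zero unfolding module_map_def by auto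
qed

lemma submodule_image:
  assumes "submodule S" "submodule T" "module_map S T \<phi>"
  shows "submodule (\<phi> ` S)"
  unfolding submodule_def
proof (intro conjI ballI)
  note S = submoduleD[OF assms(1)]
  show "subspace (\<phi> ` S)"
    unfolding subspace_def
  proof (intro conjI ballI allI)
    show "0 \<in> \<phi> ` S"
      using module_map_zero[OF assms(1,3)] S(3) by force
    show "x + y \<in> \<phi> ` S" if "x \<in> \<phi> ` S" "y \<in> \<phi> ` S" for x y
      using that by (auto simp: module_mapD(2)[OF assms(3), symmetric] intro!: imageI S(4))
    show "c *s x \<in> \<phi> ` S" if "x \<in> \<phi> ` S" for c x
      using that by (auto simp: module_mapD(3)[OF assms(3), symmetric] intro!: imageI S(6))
  qed
  show "\<phi> ` S \<subseteq> R"
    using assms(3) submoduleD(2)[OF assms(2)] unfolding module_map_def by auto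
  show "\<rho> g ` \<phi> ` S \<subseteq> \<phi> ` S" if "g \<in> carrier G" for g
    using that by (auto simp: module_mapD(4)[OF assms(3), symmetric] intro!: imageI S(7))
qed

text \<open>The kernel is a submodule of \<open>S\<close> different from \<open>S\<close>, hence
  zero; the image is a nonzero submodule of \<open>T\<close>, hence all of \<open>T\<close>.\<close>

lemma schur:
  assumes "simple_submodule S" "simple_submodule T" "module_map S T \<phi>"
    and "\<exists>x\<in>S. \<phi> x \<noteq> 0"
  shows "module_iso S T \<phi>"
proof -
  have S: "submodule S" and T: "submodule T"
    using assms unfolding simple_submodule_def by auto
  have ker: "{x \<in> S. \<phi> x = 0} = {0}"
    using submodule_kernel[OF S T assms(3)] assms(1,4) unfolding simple_submodule_def by blast
  have "inj_on \<phi> S"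
  proof (rule inj_onI)
    fix x y assume "x \<in> S" "y \<in> S" "\<phi> x = \<phi> y"
    then have "x - y \<in> {x \<in> S. \<phi> x = 0}"
      using module_map_diff[OF S assms(3)] submoduleD(5)[OF S] by simp
    then show "x = y" unfolding ker by simp
  qed
  moreover have "\<phi> ` S = T"
  proof -
    have "\<phi> ` S \<subseteq> T"
      using assms(3) unfolding module_map_def by auto
    moreover have "\<phi> ` S \<noteq> {0}"
      using assms(4) by auto
    ultimately show ?thesis
      using submodule_image[OF S T assms(3)] assms(2) unfolding simple_submodule_def by blast
  qed
  ultimately show ?thesis
    using assms(3) by (simp add: module_iso_iff bij_betw_def)
qed

section \<open>Isomorphism as an equivalence relation on submodules\<close>

lemma isomorphic_refl: "isomorphic S S"
  unfolding isomorphic_def module_iso_def by (rule exI[of _ "\<lambda>x. x"]) (auto simp: bij_betw_def)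

lemma isomorphic_trans:
  assumes "isomorphic S T" "isomorphic T U"
  shows "isomorphic S U"
proof -
  obtain \<phi> \<psi> where "module_iso S T \<phi>" "module_iso T U \<psi>"
    using assms unfolding isomorphic_def by blast
  then have "module_iso S U (\<psi> \<circ> \<phi>)"
    unfolding module_iso_def by (auto intro: bij_betw_trans dest: bij_betwE)
  then show ?thesis unfolding isomorphic_def by blast
qed

lemma isomorphic_sym:
  assumes "submodule S" "isomorphic S T"
  shows "isomorphic T S"
proof -
  obtain \<phi> where \<phi>: "module_iso S T \<phi>"
    using assms unfolding isomorphic_def by blast
  define \<theta> where "\<theta> = inv_into S \<phi>"
  have bij: "bij_betw \<phi> S T" using \<phi> unfolding module_iso_def by auto
  have \<theta>S: "\<theta> y \<in> S" "\<phi> (\<theta> y) = y" if "y \<in> T" for y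
    using bij that unfolding \<theta>_def by (auto simp: bij_betw_def inv_into_into f_inv_into_f)
  \<comment> \<open>Each law for \<open>\<theta>\<close> follows by checking that its right-hand
    side lies in \<open>S\<close> and is mapped by \<open>\<phi>\<close> to the argument on the
    left. The first check uses that \<open>S\<close> is a submodule.\<close>
  have \<theta>\<phi>: "\<theta> y = x" if "x \<in> S" "\<phi> x = y" for x y
    using bij that unfolding \<theta>_def by (auto simp: bij_betw_def inv_into_f_f)
  have "module_iso T S \<theta>"
    unfolding module_iso_def
  proof (intro conjI ballI allI)
    show "bij_betw \<theta> T S"
      using bij unfolding \<theta>_def by (rule bij_betw_inv_into)
    show "\<theta> (x + y) = \<theta> x + \<theta> y" if "x \<in> T" "y \<in> T" for x y
      using that \<theta>S \<phi> submoduleD(4)[OF assms(1)] by (intro \<theta>\<phi>) (auto simp: module_iso_def)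
    show "\<theta> (c *s x) = c *s \<theta> x" if "x \<in> T" for c x
      using that \<theta>S \<phi> submoduleD(6)[OF assms(1)] by (intro \<theta>\<phi>) (auto simp: module_iso_def)
    show "\<theta> (\<rho> g x) = \<rho> g (\<theta> x)" if "g \<in> carrier G" "x \<in> T" for g x
      using that \<theta>S \<phi> submoduleD(7)[OF assms(1)] by (intro \<theta>\<phi>) (auto simp: module_iso_def)
  qed
  then show ?thesis unfolding isomorphic_def by blast
qed

section \<open>Components in a simple decomposition\<close>

text \<open>The exact support is awkward to compute, since terms may cancel; any finite superset
  \<open>E\<close> of it gives the same sum.\<close>

lemma componentsI:
  assumes "finite E" "E \<subseteq> D" "\<And>P. P \<in> D \<Longrightarrow> x P \<in> P" "\<And>P. P \<notin> E \<Longrightarrow> x P = 0"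
    and "v = (\<Sum>P\<in>E. x P)"
  shows "components D v x"
proof -
  have sub: "{P. x P \<noteq> 0} \<subseteq> E" using assms(4) by blast
  moreover have "v = (\<Sum>P | x P \<noteq> 0. x P)"
    unfolding assms(5) using sub assms(1) by (intro sum.mono_neutral_right) auto
  ultimately show ?thesis
    unfolding components_def using assms finite_subset by blast
qed

lemma components_in: "\<lbrakk>components D v x; P \<in> D\<rbrakk> \<Longrightarrow> x P \<in> P"
  unfolding components_def by blast

lemma components_outside: "\<lbrakk>components D v x; P \<notin> D\<rbrakk> \<Longrightarrow> x P = 0"
  unfolding components_def by blast

lemma components_sum_superset:
  assumes "components D v x" "finite E" "{P. x P \<noteq> 0} \<subseteq> E"
  shows "v = (\<Sum>P\<in>E. x P)"
proof -
  have "v = (\<Sum>P | x P \<noteq> 0. x P)"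
    using assms(1) unfolding components_def by blast
  also have "\<dots> = (\<Sum>P\<in>E. x P)"
    using assms by (intro sum.mono_neutral_left) auto
  finally show ?thesis .
qed

lemma decomposition_submodule:
  "\<lbrakk>simple_decomposition D; P \<in> D\<rbrakk> \<Longrightarrow> submodule P"
  unfolding simple_decomposition_def simple_submodule_def by blast

lemma components_component:
  assumes "simple_decomposition D" "v \<in> R"
  shows "components D v (component D v)"
proof -
  have "\<exists>!x. components D v x"
    using assms unfolding simple_decomposition_def by (elim conjE) (rule bspec)
  then show ?thesis unfolding component_def by (rule theI')
qed

lemma component_eqI:
  assumes "simple_decomposition D" "v \<in> R" "components D v x"
  shows "component D v = x"
proof -
  have "\<exists>!x. components D v x"
    using assms unfolding simple_decomposition_def by (elim conjE) (rule bspec)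
  then show ?thesis unfolding component_def by (rule the1_equality) fact
qed

lemma component_of_member:
  assumes D: "simple_decomposition D" and P: "P \<in> D" and v: "v \<in> P"
  shows "component D v = (\<lambda>Q. if Q = P then v else 0)"
proof (rule component_eqI[OF D])
  show "v \<in> R" using decomposition_submodule[OF D P] submoduleD(2) v by blast
  show "components D v (\<lambda>Q. if Q = P then v else 0)"
    using P v submoduleD(3)[OF decomposition_submodule[OF D]]
    by (intro componentsI[of "{P}"]) auto
qed

text \<open>Uniqueness of components does the work: applying an operation termwise to the components
  of the arguments gives a valid family for the result, which must then be its family of
  components.\<close>

lemma component_module_map:
  assumes D: "simple_decomposition D" and P: "P \<in> D"
  shows "module_map R P (\<lambda>v. component D v P)"
  unfolding module_map_def
proof (intro conjI ballI allI)
  let ?c = "component D"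
  note sub = decomposition_submodule[OF D]
  note R = submoduleD[OF submodule_R]
  have c: "?c v Q \<in> Q" if "v \<in> R" "Q \<in> D" for v Q
    using components_component[OF D that(1)] that(2) unfolding components_def by blast
  have fin: "finite {Q. ?c v Q \<noteq> 0}" "{Q. ?c v Q \<noteq> 0} \<subseteq> D" if "v \<in> R" for v
    using components_component[OF D that] unfolding components_def by auto
  have sum: "v = (\<Sum>Q\<in>E. ?c v Q)" if "v \<in> R" "finite E" "{Q. ?c v Q \<noteq> 0} \<subseteq> E" for v E
    using components_sum_superset[OF components_component[OF D that(1)] that(2,3)] .
  show "(\<lambda>v. ?c v P) ` R \<subseteq> P"
    using c P by auto
  show "?c (x + y) P = ?c x P + ?c y P" if xy: "x \<in> R" "y \<in> R" for x y
  proof -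
    let ?E = "{Q. ?c x Q \<noteq> 0} \<union> {Q. ?c y Q \<noteq> 0}"
    have "components D (x + y) (\<lambda>Q. ?c x Q + ?c y Q)"
    proof (rule componentsI[of ?E])
      show "x + y = (\<Sum>Q\<in>?E. ?c x Q + ?c y Q)"
        using sum[OF xy(1), of ?E] sum[OF xy(2), of ?E] fin xy by (simp add: sum.distrib)
    qed (use fin xy c submoduleD(4)[OF sub] in auto)
    then show ?thesis using component_eqI[OF D R(4)[OF xy]] by simp
  qed
  show "?c (a *s x) P = a *s ?c x P" if x: "x \<in> R" for a x
  proof -
    have "components D (a *s x) (\<lambda>Q. a *s ?c x Q)"
    proof (rule componentsI[of "{Q. ?c x Q \<noteq> 0}"])
      show "a *s x = (\<Sum>Q | ?c x Q \<noteq> 0. a *s ?c x Q)"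
        using sum[OF x fin(1)[OF x] order_refl] by (metis scale_sum_right)
    qed (use fin x c submoduleD(6)[OF sub] in auto)
    then show ?thesis using component_eqI[OF D R(6)[OF x]] by simp
  qed
  show "?c (\<rho> g x) P = \<rho> g (?c x P)" if g: "g \<in> carrier G" and x: "x \<in> R" for g x
  proof -
    have "components D (\<rho> g x) (\<lambda>Q. \<rho> g (?c x Q))"
    proof (rule componentsI[of "{Q. ?c x Q \<noteq> 0}"])
      have "\<rho> g x = \<rho> g (\<Sum>Q | ?c x Q \<noteq> 0. ?c x Q)"
        using sum[OF x fin(1)[OF x] order_refl] by simp
      also have "\<dots> = (\<Sum>Q | ?c x Q \<noteq> 0. \<rho> g (?c x Q))"
        using g x c fin(2)[OF x] submoduleD(2)[OF sub] by (intro act_sum) blast+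
      finally show "\<rho> g x = (\<Sum>Q | ?c x Q \<noteq> 0. \<rho> g (?c x Q))" .
    qed (use fin g x c submoduleD(7)[OF sub] act_zero in auto)
    then show ?thesis using component_eqI[OF D R(7)[OF g x]] by simp
  qed
qed

text \<open>Genericity is used through relations whose coefficients are attached to indices, whereas
  \<open>independent\<close> attaches them to vectors. Injectivity translates between the
  two.\<close>

lemma independent_family_iff:
  "independent_family I u \<longleftrightarrow>
     (\<forall>J a. finite J \<and> J \<subseteq> I \<and> (\<Sum>i\<in>J. a i *s u i) = 0 \<longrightarrow> (\<forall>i\<in>J. a i = 0))"
  (is "_ \<longleftrightarrow> ?rhs")
proof
  assume ind: "independent_family I u"
  show ?rhs
  proof (intro allI impI ballI, elim conjE)
    fix J a i assume J: "finite J" "J \<subseteq> I" "(\<Sum>i\<in>J. a i *s u i) = 0" and i: "i \<in> J"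
    have inj: "inj_on u J" and indJ: "independent (u ` I)"
      using ind J inj_on_subset unfolding independent_family_def by auto
    \<comment> \<open>As \<open>u\<close> is injective on \<open>J\<close>, each vector in the image
      has a unique index from which to take its coefficient.\<close>
    have "(\<Sum>v\<in>u ` J. a (inv_into J u v) *s v) = 0"
      using J inj by (simp add: sum.reindex)
    then have "a (inv_into J u (u i)) = 0"
      using independentD[OF indJ, of "u ` J" "\<lambda>v. a (inv_into J u v)"] J i by blast
    then show "a i = 0" using inj i by simp
  qed
next
  assume r: ?rhs
  have inj: "inj_on u I"
  proof (rule inj_onI, rule ccontr)
    fix i j assume ij: "i \<in> I" "j \<in> I" "u i = u j" "i \<noteq> j"
    \<comment> \<open>A repeated vector gives the relation with coefficients 1 and -1, which is
      nontrivial in every characteristic.\<close>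
    have "(\<Sum>k\<in>{i, j}. (if k = i then 1 else - 1) *s u k) = 0"
      using ij by simp
    then show False
      using r[rule_format, of "{i, j}" "\<lambda>k. if k = i then 1 else - 1" i] ij by auto
  qed
  moreover have "independent (u ` I)"
    unfolding independent_explicit_finite_subsets
  proof (intro allI impI ballI)
    fix S a v assume S: "S \<subseteq> u ` I" "finite S" "(\<Sum>v\<in>S. a v *s v) = 0" "v \<in> S"
    obtain J where J: "J \<subseteq> I" "finite J" "S = u ` J"
      using S(1,2) by (meson finite_subset_image)
    have "(\<Sum>i\<in>J. a (u i) *s u i) = 0"
      using S(3) J inj_on_subset[OF inj J(1)] by (simp add: sum.reindex)
    then have "\<forall>i\<in>J. a (u i) = 0"
      using r[rule_format, of J "\<lambda>i. a (u i)"] J by blast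
    then show "a v = 0" using S(4) J(3) by blast
  qed
  ultimately show "independent_family I u"
    by (simp add: independent_family_def)
qed

section \<open>Generating and generic elements\<close>

lemma generator_independent_components:
  assumes gen: "generates_module F" and F: "F \<in> R" and D: "simple_decomposition D"
    and P': "submodule P'" and I: "I \<subseteq> D"
    and \<psi>: "\<And>P. P \<in> I \<Longrightarrow> module_iso P P' (\<psi> P)"
  shows "independent_family I (\<lambda>P. \<psi> P (component D F P))"
  unfolding independent_family_iff
proof (intro allI impI ballI, elim conjE)
  fix J a Q
  assume J: "finite J" "J \<subseteq> I" "(\<Sum>P\<in>J. a P *s \<psi> P (component D F P)) = 0" and Q: "Q \<in> J"
  \<comment> \<open>The left-hand side of the relation, with \<open>F\<close> replaced by a
    variable; the relation becomes \<open>\<phi> F = 0\<close>.\<close>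
  define \<phi> where "\<phi> v = (\<Sum>P\<in>J. a P *s \<psi> P (component D v P))" for v
  have cm: "module_map R P (\<lambda>v. component D v P)" if "P \<in> J" for P
    using that J I component_module_map[OF D] by blast
  have pm: "module_map P P' (\<psi> P)" if "P \<in> J" for P
    using that J \<psi> module_iso_iff by blast
  have cin: "component D v P \<in> P" if "P \<in> J" "v \<in> R" for v P
    using cm that unfolding module_map_def by blast
  have pin: "\<psi> P (component D v P) \<in> P'" if "P \<in> J" "v \<in> R" for v P
    using pm cin that unfolding module_map_def by blast
  have map: "module_map R P' \<phi>"
    unfolding module_map_def
  proof (intro conjI ballI allI)
    show "\<phi> ` R \<subseteq> P'"
      unfolding \<phi>_def using pin submoduleD(1,6)[OF P'] by (auto intro!: subspace_sum)
    show "\<phi> (x + y) = \<phi> x + \<phi> y" if "x \<in> R" "y \<in> R" for x y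
    proof -
      have "\<psi> P (component D (x + y) P) = \<psi> P (component D x P) + \<psi> P (component D y P)"
        if "P \<in> J" for P
        using that \<open>x \<in> R\<close> \<open>y \<in> R\<close> cm[OF that] pm[OF that] cin[OF that]
        unfolding module_map_def by simp
      then show ?thesis
        unfolding \<phi>_def sum.distrib[symmetric]
        by (intro sum.cong) (simp_all add: scale_right_distrib)
    qed
    show "\<phi> (c *s x) = c *s \<phi> x" if "x \<in> R" for c x
    proof -
      have "\<psi> P (component D (c *s x) P) = c *s \<psi> P (component D x P)" if "P \<in> J" for P
        using that \<open>x \<in> R\<close> cm[OF that] pm[OF that] cin[OF that]
        unfolding module_map_def by simp
      then show ?thesis
        unfolding \<phi>_def scale_sum_right by (intro sum.cong) (simp_all add: mult.commute)
    qed
    show "\<phi> (\<rho> g x) = \<rho> g (\<phi> x)" if g: "g \<in> carrier G" and x: "x \<in> R" for g x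
    proof -
      have "\<psi> P (component D (\<rho> g x) P) = \<rho> g (\<psi> P (component D x P))" if "P \<in> J" for P
        using that g x cm[OF that] pm[OF that] cin[OF that]
        unfolding module_map_def by simp
      moreover have "\<rho> g (\<phi> x) = (\<Sum>P\<in>J. \<rho> g (a P *s \<psi> P (component D x P)))"
        unfolding \<phi>_def using pin x g submoduleD(2,6)[OF P'] by (intro act_sum) blast+
      moreover have "\<psi> P (component D x P) \<in> R" if "P \<in> J" for P
        using pin[OF that x] submoduleD(2)[OF P'] by blast
      ultimately show ?thesis
        unfolding \<phi>_def using g by (simp add: act_scale)
    qed
  qed
  have "F \<in> {v \<in> R. \<phi> v = 0}"
    using F J(3) by (simp add: \<phi>_def)
  \<comment> \<open>The kernel of \<open>\<phi>\<close> is a submodule containing \<open>F\<close>,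
    so it contains everything that \<open>F\<close> generates, which is \<open>R\<close>.\<close>
  then have "{algebra_act b F | b. True} \<subseteq> {v \<in> R. \<phi> v = 0}"
    using algebra_act_in_submodule[OF submodule_kernel[OF submodule_R P' map]] by blast
  then have ker: "\<phi> v = 0" if "v \<in> R" for v
    using that gen unfolding generates_module_def by blast
  have QD: "Q \<in> D" using Q J I by blast
  then have subQ: "submodule Q" and "Q \<noteq> {0}"
    using D unfolding simple_decomposition_def simple_submodule_def by auto
  then obtain q where q: "q \<in> Q" "q \<noteq> 0"
    using submoduleD(3) by blast
  have zero: "\<psi> P 0 = 0" if "P \<in> J" for P
    using that module_map_zero[OF decomposition_submodule[OF D] pm] J(2) I by blast
  \<comment> \<open>An element of the summand \<open>Q\<close> has zero component in every other
    summand, so evaluating \<open>\<phi>\<close> at \<open>q\<close> isolates the coefficient of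
    \<open>Q\<close>.\<close>
  have "\<phi> q = (\<Sum>P\<in>J. if P = Q then a Q *s \<psi> Q q else 0)"
    unfolding \<phi>_def component_of_member[OF D QD q(1)]
    by (intro sum.cong) (auto simp: zero)
  also have "\<dots> = a Q *s \<psi> Q q"
    using J(1) Q by simp
  finally have "a Q *s \<psi> Q q = 0"
    using ker q(1) submoduleD(2)[OF subQ] by auto
  moreover have "\<psi> Q q \<noteq> 0"
  proof
    assume "\<psi> Q q = 0"
    then have "\<psi> Q q = \<psi> Q 0" using zero[OF Q] by simp
    moreover have "inj_on (\<psi> Q) Q"
      using \<psi> J(2) Q unfolding module_iso_def bij_betw_def by blast
    ultimately show False
      using q submoduleD(3)[OF subQ] by (auto dest: inj_onD)
  qed
  ultimately show "a Q = 0" by simp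
qed

lemma generates_imp_generic:
  assumes "generates_module F" "F \<in> R" "completely_reducible"
  shows "generic F"
proof -
  obtain D where D: "simple_decomposition D"
    using assms(3) unfolding completely_reducible_def by blast
  \<comment> \<open>The isomorphism classes within \<open>D\<close>, which form the index sets of
    the isotypic parts.\<close>
  define \<I> where "\<I> = (\<lambda>P. {Q \<in> D. isomorphic P Q}) ` D"
  note sym = isomorphic_sym[OF decomposition_submodule[OF D]]
  have "partition_on D \<I>"
  proof (rule partition_onI)
    show "\<Union>\<I> = D" unfolding \<I>_def using isomorphic_refl by auto
    show "disjnt p q" if pq: "p \<in> \<I>" "q \<in> \<I>" "p \<noteq> q" for p q
    proof (rule ccontr)
      obtain P P' where P: "P \<in> D" "p = {Q \<in> D. isomorphic P Q}"
        and P': "P' \<in> D" "q = {Q \<in> D. isomorphic P' Q}"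
        using pq unfolding \<I>_def by blast
      assume "\<not> disjnt p q"
      then have "isomorphic P P'"
        using P P' sym isomorphic_trans unfolding disjnt_iff by blast
      then have "p = q"
        unfolding P(2) P'(2) using P(1) sym isomorphic_trans by blast
      then show False using pq(3) by simp
    qed
    show "{} \<notin> \<I>" unfolding \<I>_def using isomorphic_refl by auto
  qed
  moreover have "isomorphic P P' \<longleftrightarrow> (\<exists>I\<in>\<I>. P \<in> I \<and> P' \<in> I)" if "P \<in> D" "P' \<in> D" for P P'
  proof
    assume "isomorphic P P'"
    then show "\<exists>I\<in>\<I>. P \<in> I \<and> P' \<in> I"
      using that isomorphic_refl unfolding \<I>_def by (intro bexI[OF _ imageI]) simp_all
  next
    assume "\<exists>I\<in>\<I>. P \<in> I \<and> P' \<in> I"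
    then obtain I where I: "I \<in> \<I>" "P \<in> I" "P' \<in> I" by blast
    obtain Q where "Q \<in> D" "I = {P \<in> D. isomorphic Q P}"
      using I(1) unfolding \<I>_def by (rule imageE)
    then have "Q \<in> D" "isomorphic Q P" "isomorphic Q P'"
      using I by simp_all
    then show "isomorphic P P'" using sym isomorphic_trans by meson
  qed
  moreover have "independent_family I (\<lambda>P. \<psi> P (component D F P))"
    if "I \<in> \<I>" "P' \<in> I" "\<forall>P\<in>I. module_iso P P' (\<psi> P)" for I P' \<psi>
  proof -
    have "I \<subseteq> D" using that(1) unfolding \<I>_def by auto
    then show ?thesis
      using that decomposition_submodule[OF D]
      by (intro generator_independent_components[OF assms(1,2) D]) auto
  qed
  ultimately show ?thesis
    unfolding generic_def using D by blast
qed

section \<open>Projections of \<open>R\<close> onto a simple summand that vanish on a given proper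
  submodule\<close>

lemma complement_projection:
  assumes M: "submodule M" and P: "submodule P" and int: "M \<inter> P = {0}"
    and R: "span (M \<union> P) = R"
  obtains \<phi> where "module_map R P \<phi>" "\<And>x. x \<in> M \<Longrightarrow> \<phi> x = 0" "\<And>x. x \<in> P \<Longrightarrow> \<phi> x = x"
proof -
  note M' = submoduleD[OF M] and P' = submoduleD[OF P]
  have ex: "\<exists>p. p \<in> P \<and> v - p \<in> M" if "v \<in> R" for v
  proof -
    have "v \<in> span (M \<union> P)" using that R by simp
    then obtain m p where "v = m + p" "m \<in> span M" "p \<in> span P"
      unfolding span_Un by blast
    then show ?thesis
      using M'(1) P'(1) by (intro exI[of _ p]) (simp add: span_eq_iff[THEN iffD2])
  qed
  define \<phi> where "\<phi> v = (SOME p. p \<in> P \<and> v - p \<in> M)" for v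
  have \<phi>: "\<phi> v \<in> P" "v - \<phi> v \<in> M" if "v \<in> R" for v
    using someI_ex[OF ex[OF that]] unfolding \<phi>_def by auto
  \<comment> \<open>Two candidates for the \<open>P\<close>-part of \<open>v\<close> differ by an
    element of both \<open>M\<close> and \<open>P\<close>. Each law for \<open>\<phi>\<close> now
    follows by checking that the expected value is a candidate.\<close>
  have uniq: "\<phi> v = p" if "v \<in> R" "p \<in> P" "v - p \<in> M" for v p
  proof -
    have "\<phi> v - p \<in> P" using \<phi> that P' by blast
    moreover have "(v - p) - (v - \<phi> v) \<in> M" using \<phi> that M' by blast
    ultimately have "\<phi> v - p \<in> M \<inter> P" by simp
    then show ?thesis using int by simp
  qed
  note RD = submoduleD[OF submodule_R]
  have "module_map R P \<phi>"
    unfolding module_map_def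
  proof (intro conjI ballI allI)
    show "\<phi> ` R \<subseteq> P" using \<phi> by blast
    show "\<phi> (x + y) = \<phi> x + \<phi> y" if "x \<in> R" "y \<in> R" for x y
      using that \<phi> RD(4) P'(4) M'(4)[OF \<phi>(2)[OF that(1)] \<phi>(2)[OF that(2)]]
      by (intro uniq) (auto simp: algebra_simps)
    show "\<phi> (c *s x) = c *s \<phi> x" if "x \<in> R" for c x
      using that \<phi> RD(6) P'(6) M'(6)[OF \<phi>(2)[OF that], of c]
      by (intro uniq) (auto simp: scale_right_diff_distrib)
    show "\<phi> (\<rho> g x) = \<rho> g (\<phi> x)" if g: "g \<in> carrier G" and x: "x \<in> R" for g x
    proof (rule uniq)
      have pR: "\<phi> x \<in> R" and dR: "x - \<phi> x \<in> R"
        using \<phi>[OF x] P'(2) M'(2) by auto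
      have "\<rho> g (x - \<phi> x) + \<rho> g (\<phi> x) = \<rho> g x"
        using act_add[OF g dR pR] by simp
      then have "\<rho> g x - \<rho> g (\<phi> x) = \<rho> g (x - \<phi> x)" by (simp add: algebra_simps)
      then show "\<rho> g x - \<rho> g (\<phi> x) \<in> M"
        using M'(7)[OF g \<phi>(2)[OF x]] by simp
    qed (use g x RD(7) P'(7) \<phi> in auto)
  qed
  moreover have "\<phi> x = 0" if "x \<in> M" for x
    using that M'(2) P'(3) by (intro uniq) auto
  moreover have "\<phi> x = x" if "x \<in> P" for x
    using that M'(3) P'(2) by (intro uniq) auto
  ultimately show ?thesis using that by blast
qed

text \<open>Enlarge \<open>M\<close> by as many summands as possible while keeping the sum proper.
  Any further summand \<open>P\<close> then fills up \<open>R\<close>, and simplicity of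
  \<open>P\<close> makes this last sum direct, so one can project onto \<open>P\<close> along the
  enlarged submodule.\<close>

lemma proper_submodule_projection:
  assumes D: "simple_decomposition D" and fin: "finite D"
    and M: "submodule M" and proper: "M \<noteq> R"
  obtains P \<phi> where "P \<in> D" "module_map R P \<phi>"
    "\<And>x. x \<in> M \<Longrightarrow> \<phi> x = 0" "\<And>x. x \<in> P \<Longrightarrow> \<phi> x = x"
proof -
  note sub = decomposition_submodule[OF D]
  let ?S = "\<lambda>E. span (M \<union> \<Union>E)"
  let ?A = "{E. E \<subseteq> D \<and> ?S E \<noteq> R}"
  have subS: "submodule (?S E)" if "E \<subseteq> D" for E
    using that sub M submoduleD(2,7) by (intro submodule_span) blast+
  have "?S {} = span M" by simp
  also have "span M = M"
    using submoduleD(1)[OF M] by simp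
  finally have "{} \<in> ?A" using proper by blast
  \<comment> \<open>Finiteness of \<open>D\<close> guarantees a maximal admissible set
    \<open>E\<close>.\<close>
  moreover have "finite ?A" using fin by simp
  ultimately obtain E where E: "E \<in> ?A" and max: "\<forall>E'\<in>?A. E \<subseteq> E' \<longrightarrow> E = E'"
    using finite_has_maximal[of ?A] by blast
  have "?S D = R"
  proof
    show "?S D \<subseteq> R" using subS submoduleD(2) by blast
    show "R \<subseteq> ?S D"
    proof
      fix v assume v: "v \<in> R"
      note c = components_component[OF D v]
      have "v = (\<Sum>P | component D v P \<noteq> 0. component D v P)"
        using c unfolding components_def by blast
      also have "\<dots> \<in> ?S D"
      proof (rule subspace_sum[OF subspace_span])
        fix P assume "P \<in> {P. component D v P \<noteq> 0}"
        then have "P \<in> D" "component D v P \<in> P"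
          using c unfolding components_def by blast+
        then show "component D v P \<in> ?S D" by (intro span_base) blast
      qed
      finally show "v \<in> ?S D" .
    qed
  qed
  then have "E \<noteq> D" using E by auto
  then obtain P where P: "P \<in> D" "P \<notin> E" using E by auto
  have ED: "E \<subseteq> D" "?S E \<noteq> R" using E by auto
  have full: "?S (insert P E) = R"
    using max P ED by blast
  have "M \<union> \<Union>(insert P E) \<subseteq> span (?S E \<union> P)"
    by (intro Un_least Sup_least) (auto intro!: span_base)
  then have "R \<subseteq> span (?S E \<union> P)"
    using full span_minimal subspace_span by metis
  moreover have "?S E \<union> P \<subseteq> R"
    using subS[OF ED(1)] sub[OF P(1)] submoduleD(2) by blast
  ultimately have R: "span (?S E \<union> P) = R"
    using span_minimal subspace_R by blast
  have "?S E \<inter> P = {0}"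
  proof (rule ccontr)
    assume "?S E \<inter> P \<noteq> {0}"
    moreover have "simple_submodule P"
      using D P(1) unfolding simple_decomposition_def by blast
    \<comment> \<open>A nonzero intersection is all of the simple module \<open>P\<close>, so adding
      \<open>P\<close> would not enlarge \<open>?S E\<close>, although it must give
      \<open>R\<close>.\<close>
    ultimately have "?S E \<inter> P = P"
      using submodule_Int[OF subS[OF ED(1)] sub[OF P(1)]] unfolding simple_submodule_def by blast
    then have "?S E \<union> P = ?S E" by blast
    then show False using R ED(2) by (simp add: span_span)
  qed
  then obtain \<phi> where \<phi>: "module_map R P \<phi>" "\<And>x. x \<in> ?S E \<Longrightarrow> \<phi> x = 0"
    "\<And>x. x \<in> P \<Longrightarrow> \<phi> x = x"
    using complement_projection[OF subS[OF ED(1)] sub[OF P(1)] _ R] by blast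
  show ?thesis
    using that[OF P(1) \<phi>(1) _ \<phi>(3)] \<phi>(2) span_superset[of "M \<union> \<Union>E"] by blast
qed

section \<open>Generic elements generate\<close>

lemma generic_imp_generates:
  assumes fin: "finite (carrier G)" and F: "F \<in> R" and "generic F"
  shows "generates_module F"
proof (rule ccontr)
  assume not_gen: "\<not> generates_module F"
  obtain D \<I> where D: "simple_decomposition D" and part: "partition_on D \<I>"
    and iso: "\<And>P P'. P \<in> D \<Longrightarrow> P' \<in> D \<Longrightarrow> isomorphic P P' \<longleftrightarrow> (\<exists>I\<in>\<I>. P \<in> I \<and> P' \<in> I)"
    and indep: "\<And>I P' \<psi>. I \<in> \<I> \<Longrightarrow> P' \<in> I \<Longrightarrow> (\<forall>P\<in>I. module_iso P P' (\<psi> P)) \<Longrightarrow>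
           independent_family I (\<lambda>P. \<psi> P (component D F P))"
    using assms(3) unfolding generic_def by auto
  let ?c = "component D F"
  note sub = decomposition_submodule[OF D]
  have cF: "components D F ?c" using components_component[OF D F] .
  have classes: "\<exists>I\<in>\<I>. P \<in> I \<and> I \<subseteq> D" if "P \<in> D" for P
    using part that unfolding partition_on_def by blast
  have class_iso: "\<exists>\<psi>. module_iso Q P \<psi>" if "I \<in> \<I>" "P \<in> I" "Q \<in> I" for I P Q
  proof -
    have "P \<in> D" "Q \<in> D" using part that unfolding partition_on_def by auto
    then show ?thesis using iso[of Q P] that unfolding isomorphic_def by blast
  qed
  have nz: "?c P \<noteq> 0" if P: "P \<in> D" for P
  proof
    assume 0: "?c P = 0"
    obtain I where I: "I \<in> \<I>" "P \<in> I" using classes P by blast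
    \<comment> \<open>Genericity applies only to isomorphisms chosen on the whole class
      \<open>I\<close>. Any choice will do here, because the zero component at \<open>P\<close> is
      dependent by itself.\<close>
    define \<psi> where "\<psi> Q = (SOME \<psi>. module_iso Q P \<psi>)" for Q
    have \<psi>: "\<forall>Q\<in>I. module_iso Q P (\<psi> Q)"
      unfolding \<psi>_def using someI_ex[OF class_iso[OF I]] by blast
    then have "module_map P P (\<psi> P)"
      using I(2) by (simp add: module_iso_iff)
    then have "\<psi> P 0 = 0"
      using module_map_zero[OF sub[OF P]] by simp
    then have "(\<Sum>Q\<in>{P}. 1 *s \<psi> Q (?c Q)) = 0" using 0 by simp
    then have "\<forall>Q\<in>{P}. (1::'k) = 0"
      using indep[OF I \<psi>, unfolded independent_family_iff, rule_format, of "{P}" "\<lambda>_. 1"] I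
      by auto
    then show False by simp
  qed
  \<comment> \<open>An element has finite support, so nonzero components everywhere force
    \<open>D\<close> to be finite.\<close>
  have "D \<subseteq> {P. ?c P \<noteq> 0}" using nz by blast
  then have finD: "finite D"
    using cF finite_subset unfolding components_def by blast
  obtain P \<phi> where P: "P \<in> D" and \<phi>: "module_map R P \<phi>"
    and ker: "\<And>x. x \<in> {algebra_act a F | a. True} \<Longrightarrow> \<phi> x = 0" and id: "\<And>x. x \<in> P \<Longrightarrow> \<phi> x = x"
    using proper_submodule_projection[OF D finD submodule_cyclic[OF F]] not_gen
    unfolding generates_module_def by metis
  have simple: "simple_submodule Q" if "Q \<in> D" for Q
    using that D unfolding simple_decomposition_def by blast
  have \<phi>Q: "module_map Q P \<phi>" if "Q \<in> D" for Q
    using module_map_subset[OF \<phi> submoduleD(2)[OF sub[OF that]]] .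
  obtain I where I: "I \<in> \<I>" "P \<in> I" "I \<subseteq> D" using classes P by blast
  define J where "J = {Q \<in> D. \<exists>x\<in>Q. \<phi> x \<noteq> 0}"
  have Jiso: "module_iso Q P \<phi>" if "Q \<in> J" for Q
    using schur[OF simple simple[OF P] \<phi>Q] that unfolding J_def by blast
  \<comment> \<open>Every summand that \<open>\<phi>\<close> does not kill is isomorphic to
    \<open>P\<close> by Schur's lemma, so the sum over \<open>J\<close> below involves a single
    class.\<close>
  have JI: "J \<subseteq> I"
  proof
    fix Q assume Q: "Q \<in> J"
    then have "isomorphic Q P" "Q \<in> D"
      using Jiso unfolding isomorphic_def J_def by auto
    then obtain I' where "I' \<in> \<I>" "Q \<in> I'" "P \<in> I'" using iso P by blast
    then have "I' = I"
      using I part unfolding partition_on_def disjoint_def by blast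
    then show "Q \<in> I" using \<open>Q \<in> I'\<close> by simp
  qed
  \<comment> \<open>Since \<open>\<phi>\<close> is the identity on \<open>P\<close>, the set
    \<open>J\<close> is nonempty and the relation found below is nontrivial.\<close>
  have PJ: "P \<in> J"
  proof -
    obtain p where "p \<in> P" "p \<noteq> 0"
      using simple[OF P] submoduleD(3)[OF sub[OF P]] unfolding simple_submodule_def by blast
    then show ?thesis using P id unfolding J_def by auto
  qed
  \<comment> \<open>The projection itself supplies the isomorphisms on the summands it does not kill.\<close>
  define \<psi> where "\<psi> Q = (if Q \<in> J then \<phi> else SOME \<psi>. module_iso Q P \<psi>)" for Q
  have \<psi>: "\<forall>Q\<in>I. module_iso Q P (\<psi> Q)"
    unfolding \<psi>_def using someI_ex[OF class_iso[OF I(1,2)]] Jiso by simp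
  have cR: "?c Q \<in> Q" "?c Q \<in> R" if "Q \<in> D" for Q
    using cF that submoduleD(2)[OF sub[OF that]] unfolding components_def by blast+
  have "F = (\<Sum>Q\<in>D. ?c Q)"
    using cF by (intro components_sum_superset[OF cF finD]) (auto simp: components_def)
  then have "\<phi> F = (\<Sum>Q\<in>D. \<phi> (?c Q))"
    using module_map_sum[OF submodule_R \<phi>, of D ?c] cR by metis
  \<comment> \<open>The terms outside \<open>J\<close> vanish; what remains is a relation over
    \<open>J\<close> with all coefficients 1.\<close>
  also have "\<dots> = (\<Sum>Q\<in>J. \<phi> (?c Q))"
    using finD cR(1) by (intro sum.mono_neutral_right) (auto simp: J_def)
  also have "\<dots> = (\<Sum>Q\<in>J. 1 *s \<psi> Q (?c Q))"
    by (intro sum.cong) (auto simp: \<psi>_def)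
  finally have "(\<Sum>Q\<in>J. 1 *s \<psi> Q (?c Q)) = 0"
    using ker[OF self_in_cyclic[OF fin F]] by simp
  moreover have "finite J" using finD by (simp add: J_def)
  ultimately have "\<forall>Q\<in>J. (1::'k) = 0"
    using indep[OF I(1,2) \<psi>, unfolded independent_family_iff, rule_format, of J "\<lambda>_. 1"] JI
    by auto
  then show False using PJ by auto
qed

end

section \<open>Transport of decompositions between vector spaces\<close>

text \<open>\<open>module_iso\<close> compares submodules of one module. Here the two modules may
  live in ambient spaces of different types, with different scalings and actions.\<close>

locale G_module_iso =
  M: G_module scale\<^sub>1 G W \<sigma> + N: G_module scale\<^sub>2 G R \<rho>
  for scale\<^sub>1 :: "'k::field \<Rightarrow> 'w::ab_group_add \<Rightarrow> 'w"
    and G :: "('g, 'm) monoid_scheme"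
    and W \<sigma>
    and scale\<^sub>2 :: "'k \<Rightarrow> 'v::ab_group_add \<Rightarrow> 'v"
    and R \<rho> +
  fixes \<eta> :: "'w \<Rightarrow> 'v"
  assumes bij: "bij_betw \<eta> W R"
    and map_add: "\<lbrakk>x \<in> W; y \<in> W\<rbrakk> \<Longrightarrow> \<eta> (x + y) = \<eta> x + \<eta> y"
    and map_scale: "x \<in> W \<Longrightarrow> \<eta> (scale\<^sub>1 c x) = scale\<^sub>2 c (\<eta> x)"
    and map_act: "\<lbrakk>g \<in> carrier G; x \<in> W\<rbrakk> \<Longrightarrow> \<eta> (\<sigma> g x) = \<rho> g (\<eta> x)"
begin

abbreviation \<theta> :: "'v \<Rightarrow> 'w" where "\<theta> \<equiv> inv_into W \<eta>"

lemma map_in: "x \<in> W \<Longrightarrow> \<eta> x \<in> R"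
  using bij by (auto simp: bij_betw_def)

lemma inv_in: "y \<in> R \<Longrightarrow> \<theta> y \<in> W"
  using bij by (auto simp: bij_betw_def inv_into_into)

lemma map_inv: "y \<in> R \<Longrightarrow> \<eta> (\<theta> y) = y"
  using bij by (auto simp: bij_betw_def f_inv_into_f)

lemma inv_map: "x \<in> W \<Longrightarrow> \<theta> (\<eta> x) = x"
  using bij by (auto simp: bij_betw_def)

lemma inv_eqI: "\<lbrakk>x \<in> W; \<eta> x = y\<rbrakk> \<Longrightarrow> \<theta> y = x"
  using inv_map by blast

lemma image_map_inv: "S \<subseteq> R \<Longrightarrow> \<eta> ` \<theta> ` S = S"
  using map_inv by (force simp: image_image)

lemma image_inv_map: "S \<subseteq> W \<Longrightarrow> \<theta> ` \<eta> ` S = S"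
  using inv_map by (force simp: image_image)

text \<open>With the roles exchanged, each transport result of this locale also applies from
  \<open>R\<close> back to \<open>W\<close>.\<close>

lemma inverse: "G_module_iso scale\<^sub>2 G R \<rho> scale\<^sub>1 W \<sigma> \<theta>"
proof unfold_locales
  show "bij_betw \<theta> R W" using bij by (rule bij_betw_inv_into)
  show "\<theta> (x + y) = \<theta> x + \<theta> y" if "x \<in> R" "y \<in> R" for x y
    using that inv_in map_inv map_add M.submoduleD(4)[OF M.submodule_R] by (intro inv_eqI) auto
  show "\<theta> (scale\<^sub>2 c x) = scale\<^sub>1 c (\<theta> x)" if "x \<in> R" for c x
    using that inv_in map_inv map_scale M.submoduleD(6)[OF M.submodule_R] by (intro inv_eqI) auto
  show "\<theta> (\<rho> g x) = \<sigma> g (\<theta> x)" if "g \<in> carrier G" "x \<in> R" for g x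
    using that inv_in map_inv map_act M.act_closed by (intro inv_eqI) auto
qed

lemma inv_inv: "x \<in> W \<Longrightarrow> inv_into R \<theta> x = \<eta> x"
  using G_module_iso.inv_eqI[OF inverse] map_in inv_map by blast

lemma map_zero: "\<eta> 0 = 0"
  using map_add[of 0 0] M.zero_in_R by simp

lemma map_sum: "(\<And>i. i \<in> I \<Longrightarrow> f i \<in> W) \<Longrightarrow> \<eta> (sum f I) = (\<Sum>i\<in>I. \<eta> (f i))"
  by (induction I rule: infinite_finite_induct) (auto simp: map_zero map_add M.sum_in_R)

lemma submodule_image:
  assumes "M.submodule S"
  shows "N.submodule (\<eta> ` S)"
  unfolding N.submodule_def N.subspace_def
proof (intro conjI ballI allI)
  note S = M.submoduleD[OF assms]
  have SW: "x \<in> W" if "x \<in> S" for x using that S(2) by blast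
  show "0 \<in> \<eta> ` S" using map_zero S(3) by force
  show "x + y \<in> \<eta> ` S" if "x \<in> \<eta> ` S" "y \<in> \<eta> ` S" for x y
    using that by (auto simp: map_add[OF SW SW, symmetric] intro!: imageI S(4))
  show "scale\<^sub>2 c x \<in> \<eta> ` S" if "x \<in> \<eta> ` S" for c x
    using that by (auto simp: map_scale[OF SW, symmetric] intro!: imageI S(6))
  show "\<eta> ` S \<subseteq> R" using SW map_in by blast
  show "\<rho> g ` \<eta> ` S \<subseteq> \<eta> ` S" if "g \<in> carrier G" for g
    using that by (auto simp: map_act[OF _ SW, symmetric] intro!: imageI S(7))
qed

lemma simple_submodule_image:
  assumes "M.simple_submodule S"
  shows "N.simple_submodule (\<eta> ` S)"
  unfolding N.simple_submodule_def
proof (intro conjI allI impI, goal_cases)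
  have S: "M.submodule S" "S \<subseteq> W"
    using assms M.submoduleD(2) unfolding M.simple_submodule_def by auto
  case 1
  show ?case using submodule_image S(1) .
next
  case 2
  have S: "S \<subseteq> W" "S \<noteq> {0}"
    using assms M.submoduleD(2) unfolding M.simple_submodule_def by auto
  show ?case
  proof
    assume "\<eta> ` S = {0}"
    then have "\<theta> ` \<eta> ` S = {\<theta> 0}" by simp
    moreover have "\<theta> 0 = 0" using inv_eqI[OF M.zero_in_R map_zero] .
    ultimately show False using S image_inv_map by simp
  qed
next
  case (3 T)
  then have T: "N.submodule T" "T \<subseteq> \<eta> ` S" "T \<subseteq> R" using N.submoduleD(2) by auto
  have S: "S \<subseteq> W" using assms M.submoduleD(2) unfolding M.simple_submodule_def by auto
  \<comment> \<open>Simplicity is tested on the other side: a submodule of the image is pulled back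
    into \<open>S\<close> and the resulting alternative is mapped forward again.\<close>
  have "M.submodule (\<theta> ` T)"
    using G_module_iso.submodule_image[OF inverse T(1)] .
  moreover have "\<theta> ` T \<subseteq> S"
    using T(2) image_inv_map[OF S] by blast
  ultimately have "\<theta> ` T = {0} \<or> \<theta> ` T = S"
    using assms unfolding M.simple_submodule_def by blast
  then have "\<eta> ` \<theta> ` T = {0} \<or> \<eta> ` \<theta> ` T = \<eta> ` S"
    by (elim disjE) (simp_all add: map_zero)
  then show ?case using image_map_inv T(3) by simp
qed

lemma components_image:
  assumes D: "\<And>P. P \<in> D \<Longrightarrow> P \<subseteq> W" and x: "M.components D w x"
  shows "N.components ((`) \<eta> ` D) (\<eta> w)
           (\<lambda>Q. if Q \<in> (`) \<eta> ` D then \<eta> (x (\<theta> ` Q)) else 0)"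
proof -
  let ?E = "{P. x P \<noteq> 0}"
  let ?y = "\<lambda>Q. if Q \<in> (`) \<eta> ` D then \<eta> (x (\<theta> ` Q)) else 0"
  have inP: "x P \<in> P" if "P \<in> D" for P
    using x that unfolding M.components_def by blast
  have ED: "?E \<subseteq> D" and fin: "finite ?E" and w: "w = (\<Sum>P\<in>?E. x P)"
    using x unfolding M.components_def by auto
  have y: "?y (\<eta> ` P) = \<eta> (x P)" if "P \<in> D" for P
    using that image_inv_map[OF D] by simp
  have inj: "inj_on ((`) \<eta>) ?E"
    using ED D image_inv_map by (intro inj_on_inverseI[of _ "(`) \<theta>"]) blast
  show ?thesis
  proof (rule N.componentsI[of "(`) \<eta> ` ?E"])
    show "finite ((`) \<eta> ` ?E)" using fin by simp
    show "(`) \<eta> ` ?E \<subseteq> (`) \<eta> ` D" using ED by blast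
    show "?y Q \<in> Q" if "Q \<in> (`) \<eta> ` D" for Q
      using that y inP by auto
    show "?y Q = 0" if "Q \<notin> (`) \<eta> ` ?E" for Q
    proof (cases "Q \<in> (`) \<eta> ` D")
      case True
      then obtain P where P: "P \<in> D" "Q = \<eta> ` P" by blast
      then have "x P = 0" using that by blast
      then show ?thesis using y[OF P(1)] map_zero unfolding P(2) by simp
    qed simp
    have "\<eta> w = (\<Sum>P\<in>?E. \<eta> (x P))"
      unfolding w using ED inP D by (intro map_sum) blast
    also have "\<dots> = (\<Sum>P\<in>?E. ?y (\<eta> ` P))"
    proof (rule sum.cong)
      fix P assume "P \<in> ?E"
      then have "P \<in> D" using ED by blast
      then show "\<eta> (x P) = ?y (\<eta> ` P)" using y by metis
    qed simp
    also have "\<dots> = (\<Sum>Q\<in>(`) \<eta> ` ?E. ?y Q)"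
      using sum.reindex[OF inj, of ?y] by simp
    finally show "\<eta> w = (\<Sum>Q\<in>(`) \<eta> ` ?E. ?y Q)" .
  qed
qed

text \<open>Existence comes from pushing forward the components of \<open>\<theta> v\<close>. For
  uniqueness, two families for \<open>v\<close> are pulled back to \<open>W\<close>, where both must
  be the components of \<open>\<theta> v\<close>.\<close>

lemma simple_decomposition_image:
  assumes "M.simple_decomposition D"
  shows "N.simple_decomposition ((`) \<eta> ` D)"
  unfolding N.simple_decomposition_def
proof (intro conjI ballI ex_ex1I)
  let ?D = "(`) \<eta> ` D"
  have DW: "P \<subseteq> W" if "P \<in> D" for P
    using M.submoduleD(2)[OF M.decomposition_submodule[OF assms that]] .
  show "N.simple_submodule Q" if "Q \<in> ?D" for Q
    using that assms simple_submodule_image unfolding M.simple_decomposition_def by blast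
  show "\<exists>x. N.components ?D v x" if v: "v \<in> R" for v
    using components_image[OF DW M.components_component[OF assms inv_in[OF v]]] map_inv[OF v]
    by auto
  show "y = y'" if v: "v \<in> R" and y: "N.components ?D v y" "N.components ?D v y'" for v y y'
  proof
    fix Q
    have DR: "Q \<subseteq> R" if "Q \<in> ?D" for Q
      using that DW map_in by blast
    have "(`) \<theta> ` ?D = (\<lambda>P. \<theta> ` \<eta> ` P) ` D"
      by (rule image_image)
    also have "\<dots> = (\<lambda>P. P) ` D"
      by (rule image_cong[OF refl image_inv_map[OF DW]])
    finally have DD: "(`) \<theta> ` ?D = D" by simp
    let ?x = "\<lambda>y P. if P \<in> D then \<theta> (y (inv_into R \<theta> ` P)) else 0"
    have x: "M.component D (\<theta> v) = ?x y" if "N.components ?D v y" for y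
      using G_module_iso.components_image[OF inverse DR that]
      unfolding DD by (rule M.component_eqI[OF assms inv_in[OF v]])
    have eq: "?x y = ?x y'"
      using x[OF y(1)] x[OF y(2)] by (rule trans[OF sym])
    show "y Q = y' Q"
    proof (cases "Q \<in> ?D")
      case True
      then obtain P where P: "P \<in> D" "Q = \<eta> ` P" by blast
      \<comment> \<open>The pulled-back families are indexed through the inverse of
        \<open>\<theta>\<close>, which agrees with \<open>\<eta>\<close> on \<open>W\<close>; hence
        their value at \<open>P\<close> comes from \<open>Q\<close>.\<close>
      have "inv_into R \<theta> ` P = Q"
        using P DW inv_inv by (auto simp: image_iff subset_iff)
      then have \<theta>eq: "\<theta> (y Q) = \<theta> (y' Q)"
        using fun_cong[OF eq, of P] P(1) by simp
      have R: "y Q \<in> R" "y' Q \<in> R"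
        using N.components_in[OF y(1) True] N.components_in[OF y(2) True] DR[OF True] by auto
      have "y Q = \<eta> (\<theta> (y Q))" by (rule map_inv[OF R(1), symmetric])
      also have "\<dots> = \<eta> (\<theta> (y' Q))" by (simp only: \<theta>eq)
      also have "\<dots> = y' Q" by (rule map_inv[OF R(2)])
      finally show ?thesis .
    next
      case False
      then show ?thesis
        using N.components_outside[OF y(1)] N.components_outside[OF y(2)] by simp
    qed
  qed
qed

end

section \<open>Embedding a representation into a space of coordinate functions\<close>

lemma G_module_transport:
  fixes scale\<^sub>1 :: "'k::field \<Rightarrow> 'w::ab_group_add \<Rightarrow> 'w"
    and scale\<^sub>2 :: "'k \<Rightarrow> 'v::ab_group_add \<Rightarrow> 'v"
  assumes "G_module scale\<^sub>2 G R \<rho>" and vs: "vector_space scale\<^sub>1"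
    and inj: "inj_on \<tau> R"
    and add: "\<And>x y. \<lbrakk>x \<in> R; y \<in> R\<rbrakk> \<Longrightarrow> \<tau> (x + y) = \<tau> x + \<tau> y"
    and scale: "\<And>c x. x \<in> R \<Longrightarrow> \<tau> (scale\<^sub>2 c x) = scale\<^sub>1 c (\<tau> x)"
  shows "\<exists>\<sigma>. G_module_iso scale\<^sub>2 G R \<rho> scale\<^sub>1 (\<tau> ` R) \<sigma> \<tau>"
proof -
  interpret N: G_module scale\<^sub>2 G R \<rho> by fact
  interpret V: vector_space scale\<^sub>1 by fact
  note R = N.submoduleD[OF N.submodule_R]
  let ?W = "\<tau> ` R"
  define \<eta> where "\<eta> = inv_into R \<tau>"
  \<comment> \<open>The action conjugated by \<open>\<tau>\<close>. The restriction makes it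
    \<open>undefined\<close> off the image, as membership in \<open>Bij\<close> requires.\<close>
  define \<sigma> where "\<sigma> g = (\<lambda>w\<in>?W. \<tau> (\<rho> g (\<eta> w)))" for g
  have \<eta>: "\<eta> (\<tau> x) = x" if "x \<in> R" for x
    using that inj by (simp add: \<eta>_def)
  have \<sigma>: "\<sigma> g (\<tau> x) = \<tau> (\<rho> g x)" if "x \<in> R" for g x
    using that \<eta> by (simp add: \<sigma>_def)
  have \<sigma>Bij: "\<sigma> g \<in> Bij ?W" if g: "g \<in> carrier G" for g
  proof -
    have "x = y" if "x \<in> R" "y \<in> R" "\<tau> (\<rho> g x) = \<tau> (\<rho> g y)" for x y
      using that N.act_closed[OF g] inj_onD[OF inj] inj_onD[OF N.inj_prop[OF g]] by blast
    then have "inj_on (\<sigma> g) ?W"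
      using \<sigma> by (auto simp: inj_on_def)
    moreover have "\<sigma> g ` ?W = ?W"
    proof -
      have "\<sigma> g ` ?W = \<tau> ` \<rho> g ` R"
        using \<sigma> by (simp add: image_image)
      then show ?thesis using N.surj_prop[OF g] by simp
    qed
    ultimately show ?thesis
      by (simp add: Bij_def bij_betw_def \<sigma>_def)
  qed
  have hom: "group_hom G (BijGroup ?W) \<sigma>"
  proof (intro group_hom.intro group_hom_axioms.intro homI)
    show "Group.group G" by (rule group_hom.axioms(1)[OF N.group_hom])
    show "Group.group (BijGroup ?W)" by (rule group_BijGroup)
    show "\<sigma> g \<in> carrier (BijGroup ?W)" if "g \<in> carrier G" for g
      using \<sigma>Bij[OF that] by (simp add: BijGroup_def)
    show "\<sigma> (g \<otimes>\<^bsub>G\<^esub> h) = \<sigma> g \<otimes>\<^bsub>BijGroup ?W\<^esub> \<sigma> h" if gh: "g \<in> carrier G" "h \<in> carrier G" for g h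
    proof -
      have "\<sigma> (g \<otimes>\<^bsub>G\<^esub> h) = compose ?W (\<sigma> g) (\<sigma> h)"
      proof
        fix w
        show "\<sigma> (g \<otimes>\<^bsub>G\<^esub> h) w = compose ?W (\<sigma> g) (\<sigma> h) w"
        proof (cases "w \<in> ?W")
          case True
          then obtain x where x: "x \<in> R" "w = \<tau> x" by blast
          then show ?thesis
            using gh N.act_closed by (simp add: \<sigma> compose_eq N.composition_rule)
        next
          case False
          then show ?thesis by (simp add: \<sigma>_def compose_def)
        qed
      qed
      then show ?thesis using gh \<sigma>Bij by (simp add: BijGroup_def)
    qed
  qed
  have sub: "V.subspace ?W"
    unfolding V.subspace_def
  proof (intro conjI ballI allI)
    have "\<tau> 0 = 0" using add[OF R(3) R(3)] by simp
    then show "0 \<in> ?W" using R(3) by force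
    show "x + y \<in> ?W" if "x \<in> ?W" "y \<in> ?W" for x y
      using that by (auto simp: add[symmetric] intro!: imageI R(4))
    show "scale\<^sub>1 c x \<in> ?W" if "x \<in> ?W" for c x
      using that by (auto simp: scale[symmetric] intro!: imageI R(6))
  qed
  have "G_module scale\<^sub>1 G ?W \<sigma>"
  proof (intro G_module.intro G_module_axioms.intro vs group_action.intro hom sub)
    fix g x y assume g: "g \<in> carrier G" and "x \<in> ?W" "y \<in> ?W"
    then obtain x' y' where "x' \<in> R" "x = \<tau> x'" "y' \<in> R" "y = \<tau> y'" by blast
    then show "\<sigma> g (x + y) = \<sigma> g x + \<sigma> g y"
      using g R N.act_closed by (simp add: add[symmetric] \<sigma> N.act_add)
  next
    fix g x c assume g: "g \<in> carrier G" and "x \<in> ?W"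
    then obtain x' where "x' \<in> R" "x = \<tau> x'" by blast
    then show "\<sigma> g (scale\<^sub>1 c x) = scale\<^sub>1 c (\<sigma> g x)"
      using g R N.act_closed by (simp add: scale[symmetric] \<sigma> N.act_scale)
  qed
  then have "G_module_iso scale\<^sub>2 G R \<rho> scale\<^sub>1 ?W \<sigma> \<tau>"
    using N.G_module_axioms inj add scale \<sigma>
    by (auto intro!: G_module_iso.intro G_module_iso_axioms.intro simp: bij_betw_def)
  then show ?thesis by blast
qed

text \<open>The hypothesis concerns modules of functions on \<open>nat + 'v\<close>. Coordinates
  with respect to a basis give a copy of \<open>R\<close> there; its decomposition is then carried
  back.\<close>

lemma (in G_module) completely_reducible_if_all:
  assumes all: "all_representations_completely_reducible G TYPE('k) TYPE(nat + 'v)"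
  shows "completely_reducible"
proof -
  let ?s = "\<lambda>(c::'k) w (i::nat + 'v). c * w i"
  obtain B where B: "B \<subseteq> R" "independent B" "R \<subseteq> span B"
    using maximal_independent_subset by blast
  \<comment> \<open>Basis vectors are elements of \<open>'v\<close>, so coordinates occupy the
    \<open>Inr\<close> part and the \<open>nat\<close> part is filled with zeros. A vector is
    recovered from its coordinates, so \<open>\<tau>\<close> is injective on
    \<open>R\<close>.\<close>
  define \<tau> where "\<tau> v = case_sum (\<lambda>_::nat. 0) (representation B v)" for v
  have "\<exists>\<sigma>. G_module_iso scale G R \<rho> ?s (\<tau> ` R) \<sigma> \<tau>"
  proof (rule G_module_transport[OF G_module_axioms])
    show "vector_space ?s"
      by unfold_locales (auto simp: algebra_simps fun_eq_iff)
    show "inj_on \<tau> R"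
    proof (rule inj_onI)
      fix x y assume xy: "x \<in> R" "y \<in> R" "\<tau> x = \<tau> y"
      have "representation B x b = representation B y b" for b
        using fun_cong[OF xy(3), of "Inr b"] by (simp add: \<tau>_def)
      then have "representation B x = representation B y" by blast
      then show "x = y"
        using sum_nonzero_representation_eq[OF B(2), of x]
          sum_nonzero_representation_eq[OF B(2), of y] xy B(3) by auto
    qed
    show "\<tau> (x + y) = \<tau> x + \<tau> y" if "x \<in> R" "y \<in> R" for x y
      using that B by (auto simp: \<tau>_def fun_eq_iff representation_add subset_iff split: sum.split)
    show "\<tau> (c *s x) = ?s c (\<tau> x)" if "x \<in> R" for c x
      using that B by (auto simp: \<tau>_def fun_eq_iff representation_scale subset_iff split: sum.split)
  qed
  then obtain \<sigma> where \<sigma>: "G_module_iso scale G R \<rho> ?s (\<tau> ` R) \<sigma> \<tau>" by blast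
  then have "G_module ?s G (\<tau> ` R) \<sigma>"
    by (rule G_module_iso.axioms(2))
  then have "G_module.completely_reducible ?s G (\<tau> ` R) \<sigma>"
    using all unfolding all_representations_completely_reducible_def by blast
  then obtain D where "G_module.simple_decomposition ?s G (\<tau> ` R) \<sigma> D"
    unfolding G_module.completely_reducible_def[OF \<open>G_module ?s G (\<tau> ` R) \<sigma>\<close>] by blast
  then show ?thesis
    using G_module_iso.simple_decomposition_image[OF G_module_iso.inverse[OF \<sigma>]]
    unfolding completely_reducible_def by blast
qed

theorem mainTheorem1:
  fixes scale :: "'k::field \<Rightarrow> 'v::ab_group_add \<Rightarrow> 'v"
    and G :: "('g, 'm) monoid_scheme"
    and R :: "'v set"
    and \<rho> :: "'g \<Rightarrow> 'v \<Rightarrow> 'v"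
    and F :: 'v
  assumes "group G" and "finite (carrier G)"
    and "all_representations_completely_reducible G TYPE('k) TYPE(nat + 'v)"
    and "G_module scale G R \<rho>"
    and "F \<in> R"
  shows "G_module.generates_module scale G R \<rho> F \<longleftrightarrow> G_module.generic scale G R \<rho> F"
proof -
  interpret G_module scale G R \<rho> by fact
  show ?thesis
    using generates_imp_generic[OF _ assms(5) completely_reducible_if_all[OF assms(3)]]
      generic_imp_generates[OF assms(2,5)] by blast
qed

end
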